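(* $\theta_1^*=1$.
   Context: For $d\ge1$, call a probability density $f$ on $\mathbb R^d$ admissible if it is smooth, strictly positive, rapidly decaying, and $\mathcal Q[f]>0$. Define $\theta_d^*=\inf_f \mathcal I[f]\mathcal D[f]/\mathcal Q[f]^2$, the infimum over admissible densities on $\mathbb R^d$. Here, writing $f=e^u$ and $\mathsf H_f=-\nabla^2u$: $\mathcal I[f]=\int\operatorname{tr}(\mathsf H_f)f\,dx$, $\mathcal Q[f]=\int\operatorname{tr}(\mathsf H_f^2)f\,dx$, $\mathcal D[f]=\int(|\nabla\mathsf H_f|^2+2\operatorname{tr}(\mathsf H_f^3))f\,dx$, with $|\nabla\mathsf H_f|^2=\sum_{i,j,k}(\partial_k(\mathsf H_f)_{ij})^2$. (In dimension one, $\mathsf H_f=-(\log f)''$.) *)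

theory Defs
  imports "HOL-Analysis.Analysis"
begin

definition nderiv :: "nat \<Rightarrow> (real \<Rightarrow> real) \<Rightarrow> real \<Rightarrow> real" where
  "nderiv n f = (deriv ^^ n) f"

definition smooth_fun :: "(real \<Rightarrow> real) \<Rightarrow> bool" where
  "smooth_fun f \<longleftrightarrow> (\<forall>n x. nderiv n f differentiable (at x))"

definition rapidly_decaying :: "(real \<Rightarrow> real) \<Rightarrow> bool" where
  "rapidly_decaying f \<longleftrightarrow> (\<forall>k::nat. ((\<lambda>x. \<bar>x\<bar> ^ k * f x) \<longlongrightarrow> 0) at_infinity)"

definition Hf :: "(real \<Rightarrow> real) \<Rightarrow> real \<Rightarrow> real" where
  "Hf f = (\<lambda>x. - nderiv 2 (\<lambda>y. ln (f y)) x)"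

definition integrand_I :: "(real \<Rightarrow> real) \<Rightarrow> real \<Rightarrow> real" where
  "integrand_I f = (\<lambda>x. Hf f x * f x)"

definition integrand_Q :: "(real \<Rightarrow> real) \<Rightarrow> real \<Rightarrow> real" where
  "integrand_Q f = (\<lambda>x. (Hf f x)\<^sup>2 * f x)"

text \<open>In dimension one, |grad H|^2 = (H')^2 and tr(H^3) = H^3.\<close>
definition integrand_D :: "(real \<Rightarrow> real) \<Rightarrow> real \<Rightarrow> real" where
  "integrand_D f = (\<lambda>x. ((deriv (Hf f) x)\<^sup>2 + 2 * (Hf f x) ^ 3) * f x)"

definition Ifun :: "(real \<Rightarrow> real) \<Rightarrow> real" where
  "Ifun f = (\<integral>x. integrand_I f x \<partial>lborel)"

definition Qfun :: "(real \<Rightarrow> real) \<Rightarrow> real" where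
  "Qfun f = (\<integral>x. integrand_Q f x \<partial>lborel)"

definition Dfun :: "(real \<Rightarrow> real) \<Rightarrow> real" where
  "Dfun f = (\<integral>x. integrand_D f x \<partial>lborel)"

definition admissible1 :: "(real \<Rightarrow> real) \<Rightarrow> bool" where
  "admissible1 f \<longleftrightarrow>
     smooth_fun f \<and> (\<forall>x. f x > 0) \<and> rapidly_decaying f \<and>
     integrable lborel f \<and> (\<integral>x. f x \<partial>lborel) = 1 \<and>
     integrable lborel (integrand_I f) \<and> integrable lborel (integrand_Q f) \<and>
     integrable lborel (integrand_D f) \<and> Qfun f > 0"

definition theta1_star :: real where
  "theta1_star = Inf {Ifun f * Dfun f / (Qfun f)\<^sup>2 | f. admissible1 f}"

end

(* Put u = ln f, v = u', h = -u''. For every real l, D - 2 l Q + l^2 I is the integral of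
   (h'^2 + 2 h^3 - 2 l h^2 + l^2 h) f. Adding the derivative of F f for a suitable polynomial F in v, h, l
   turns the integrand into ((h' + 2 h v - l v - v^3/3)^2 + v^6/45) f, so the quadratic in l is
   nonnegative and Q^2 <= I D.
   Equality is approached when v is small against sqrt l and v'' is nearly -l v: take f proportional to
   exp (-x^2/2 + a cos (t x)) with t = 1/a^2 and a tending to 0. Then h is dominated by
   a t^2 cos (t x), and the Gaussian averages of cos^2 and sin^2 both tend to 1/2. *)
theory Submission
  imports Defs "HOL-Probability.Probability" "HOL-Real_Asymp.Real_Asymp"
begin

section \<open>The lower bound\<close>

text \<open>Squaring removes the corner of the positive part at 0, so a cutoff built from it can be
  differentiated across its threshold.\<close>

lemma has_real_derivative_pos_part_sq:
  "((\<lambda>y::real. (max 0 y)\<^sup>2) has_real_derivative 2 * max 0 y) (at y)"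
proof -
  consider "y < 0" | "y > 0" | "y = 0" by linarith
  then show ?thesis
  proof cases
    case 1
    have "((\<lambda>y::real. 0) has_real_derivative 0) (at y)" by simp
    then have "((\<lambda>y::real. (max 0 y)\<^sup>2) has_real_derivative 0) (at y)"
      by (rule has_field_derivative_transform_within_open[where S = "{..<0}"]) (use 1 in auto)
    with 1 show ?thesis by simp
  next
    case 2
    have "((\<lambda>y::real. y\<^sup>2) has_real_derivative 2 * y) (at y)"
      by (auto intro!: derivative_eq_intros)
    then have "((\<lambda>y::real. (max 0 y)\<^sup>2) has_real_derivative 2 * y) (at y)"
      by (rule has_field_derivative_transform_within_open[where S = "{0<..}"]) (use 2 in auto)
    with 2 show ?thesis by simp
  next
    case 3
    have "((\<lambda>k::real. ((max 0 k)\<^sup>2 - 0) / k) \<longlongrightarrow> 0) (at 0)"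
    proof (rule Lim_null_comparison)
      show "\<forall>\<^sub>F k in at (0::real). norm (((max 0 k)\<^sup>2 - 0) / k) \<le> \<bar>k\<bar>"
        by (intro always_eventually allI) (auto simp: max_def power2_eq_square)
      show "((\<lambda>k::real. \<bar>k\<bar>) \<longlongrightarrow> 0) (at 0)"
        by (auto intro!: tendsto_eq_intros)
    qed
    then show ?thesis using 3 by (simp add: has_field_derivative_iff)
  qed
qed

text \<open>The bracket on the left is \<open>F' + v F\<close> for \<open>F = v q\<close>,
  \<open>q = (l - h + v\<^sup>2/3)\<^sup>2 + h\<^sup>2 + v\<^sup>4/45\<close>, computed with \<open>v' = - h\<close>. The coefficients of \<open>F\<close> are
  forced by asking for a sum of squares on the right.\<close>

lemma dissipation_identity:
  fixes v h h' l :: real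
  shows "h'\<^sup>2 + 2 * h ^ 3 - 2 * l * h\<^sup>2 + l\<^sup>2 * h
    + (- h * ((l - h + v\<^sup>2/3)\<^sup>2 + h\<^sup>2 + v ^ 4/45)
       + v * (2 * (l - h + v\<^sup>2/3) * (- h' - 2/3 * v * h) + 2 * h * h' - 4/45 * v ^ 3 * h)
       + v\<^sup>2 * ((l - h + v\<^sup>2/3)\<^sup>2 + h\<^sup>2 + v ^ 4/45))
    = (h' + 2 * h * v - l * v - v ^ 3/3)\<^sup>2 + v ^ 6/45"
  by (simp add: field_simps power2_eq_square power3_eq_cube numeral_eq_Suc)

text \<open>The cutoff is an increasing function of \<open>f\<close> itself, so its derivative has the sign of
  \<open>v\<close> and the boundary term \<open>F v = v\<^sup>2 q\<close> has a sign. No decay of the derivatives of \<open>f\<close> is needed.\<close>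

lemma truncated_dissipation_nonneg:
  fixes f v h h' :: "real \<Rightarrow> real" and l e :: real
  assumes f: "\<And>x. (f has_real_derivative v x * f x) (at x)"
    and v: "\<And>x. (v has_real_derivative - h x) (at x)"
    and h: "\<And>x. (h has_real_derivative h' x) (at x)"
    and pos: "\<And>x. f x > 0" and lim: "(f \<longlongrightarrow> 0) at_infinity" and e: "e > 0"
    and J: "((\<lambda>x. ((h' x)\<^sup>2 + 2 * h x ^ 3 - 2 * l * (h x)\<^sup>2 + l\<^sup>2 * h x) * f x
      * (max 0 (1 - e / f x))\<^sup>2) has_integral J) UNIV" (is "(?g has_integral J) UNIV")
  shows "0 \<le> J"
proof -
  \<comment> \<open>The correction is \<open>F = v * q\<close> as in the identity above;
    \<open>q'\<close> is the derivative of \<open>q\<close> under \<open>v' = - h\<close>.\<close>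
  define q where "q x = (l - h x + (v x)\<^sup>2/3)\<^sup>2 + (h x)\<^sup>2 + v x ^ 4/45" for x
  define q' where "q' x = 2 * (l - h x + (v x)\<^sup>2/3) * (- h' x - 2/3 * v x * h x) + 2 * h x * h' x
    - 4/45 * v x ^ 3 * h x" for x
  define m where "m x = max 0 (1 - e / f x)" for x
  define \<Phi> where "\<Phi> x = v x * q x * f x * (m x)\<^sup>2" for x
  define \<Phi>' where "\<Phi>' x = (- h x * q x + v x * q' x + (v x)\<^sup>2 * q x) * f x * (m x)\<^sup>2
    + 2 * e * m x * (v x)\<^sup>2 * q x" for x
  have q: "(q has_real_derivative q' x) (at x)" for x
    unfolding q_def[abs_def] q'_def
    by (rule derivative_eq_intros v h refl | simp)+ (simp add: field_simps power2_eq_square power3_eq_cube)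
  have y: "((\<lambda>x. 1 - e / f x) has_real_derivative e * v x / f x) (at x)" for x
    using pos[of x] by (auto intro!: derivative_eq_intros f simp: field_simps)
  have m: "((\<lambda>x. (m x)\<^sup>2) has_real_derivative 2 * m x * (e * v x / f x)) (at x)" for x
    unfolding m_def using DERIV_chain2[OF has_real_derivative_pos_part_sq y] .
  have D: "(\<Phi> has_real_derivative \<Phi>' x) (at x)" for x
    unfolding \<Phi>_def[abs_def] \<Phi>'_def using pos[of x]
    by (intro DERIV_cong[OF DERIV_mult[OF DERIV_mult[OF DERIV_mult[OF v q] f] m]])
      (simp add: field_simps power2_eq_square)
  from lim e have "\<forall>\<^sub>F x in at_infinity. f x < e" by (rule order_tendstoD(2))
  then obtain b where b: "\<And>x. b \<le> norm x \<Longrightarrow> f x < e" unfolding eventually_at_infinity by auto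
  \<comment> \<open>The absolute value gives \<open>-R \<le> R\<close>. The fact \<open>m0\<close>
    covers the endpoints too, so both boundary values of \<open>\<Phi>\<close> vanish.\<close>
  define R where "R = \<bar>b\<bar>"
  have m0: "m x = 0" if "R \<le> \<bar>x\<bar>" for x
  proof -
    have "b \<le> norm x" using that by (simp add: R_def)
    from b[OF this] show ?thesis using pos[of x] unfolding m_def by (simp add: max_def pos_divide_le_eq)
  qed
  \<comment> \<open>For the gauge integral a pointwise derivative suffices, so \<open>h'\<close> may
    be discontinuous.\<close>
  have ftc: "(\<Phi>' has_integral \<Phi> R - \<Phi> (-R)) {-R..R}"
    by (rule fundamental_theorem_of_calculus)
      (auto simp: R_def intro: D[THEN DERIV_subset, THEN has_real_derivative_iff_has_vector_derivative[THEN iffD1]])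
  have "\<Phi> R = 0" "\<Phi> (-R) = 0" using m0[of R] m0[of "-R"] by (auto simp: \<Phi>_def R_def)
  then have 1: "((\<lambda>x. - \<Phi>' x) has_integral 0) {-R..R}"
    using has_integral_neg[OF ftc] by simp
  have "((\<lambda>x. if x \<in> {-R..R} then ?g x else 0) has_integral J) UNIV"
  proof (rule has_integral_eq[OF _ J])
    fix x
    have "m x = 0" if "x \<notin> {-R..R}"
      using that by (intro m0) auto
    then show "?g x = (if x \<in> {-R..R} then ?g x else 0)"
      unfolding m_def[symmetric] by simp
  qed
  then have 2: "(?g has_integral J) {-R..R}"
    by (simp only: has_integral_restrict_UNIV)
  from 1 2 show ?thesis
  proof (rule has_integral_le)
    fix x
    \<comment> \<open>The first summand is the sum of squares from the identity, weighted by
      \<open>f\<close> and the cutoff; the second is left over from differentiating the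
      cutoff.\<close>
    have "?g x + \<Phi>' x = ((h' x + 2 * h x * v x - l * v x - v x ^ 3/3)\<^sup>2 + v x ^ 6/45) * (f x * (m x)\<^sup>2)
      + 2 * e * m x * (v x)\<^sup>2 * q x"
      unfolding dissipation_identity[symmetric] \<Phi>'_def q_def q'_def m_def[symmetric]
      by (simp add: algebra_simps)
    also have "\<dots> \<ge> 0"
      using pos[of x] e by (auto simp: q_def m_def intro!: add_nonneg_nonneg mult_nonneg_nonneg less_imp_le)
    finally show "- \<Phi>' x \<le> ?g x" by simp
  qed
qed

text \<open>The threshold \<open>e = 1/(n+1)\<close> is sent to 0. As \<open>f\<close> is positive,
  the cutoff tends to 1 at every point; it stays between 0 and 1, so the integrand dominates its
  truncations.\<close>

lemma dissipation_nonneg: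
  fixes f v h h' :: "real \<Rightarrow> real" and l :: real
  assumes f: "\<And>x. (f has_real_derivative v x * f x) (at x)"
    and v: "\<And>x. (v has_real_derivative - h x) (at x)"
    and h: "\<And>x. (h has_real_derivative h' x) (at x)"
    and pos: "\<And>x. f x > 0" and lim: "(f \<longlongrightarrow> 0) at_infinity"
    and int: "integrable lborel
      (\<lambda>x. ((h' x)\<^sup>2 + 2 * h x ^ 3 - 2 * l * (h x)\<^sup>2 + l\<^sup>2 * h x) * f x)" (is "integrable _ ?g")
  shows "0 \<le> (\<integral>x. ((h' x)\<^sup>2 + 2 * h x ^ 3 - 2 * l * (h x)\<^sup>2 + l\<^sup>2 * h x) * f x \<partial>lborel)"
proof -
  define \<phi> where "\<phi> n x = (max 0 (1 - inverse (real (Suc n)) / f x))\<^sup>2" for n x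
  have contf: "continuous_on UNIV f" by (rule DERIV_continuous_on[OF f[THEN DERIV_subset]]) auto
  have "\<phi> n \<in> borel_measurable borel" for n
    unfolding \<phi>_def[abs_def] using pos
    by (intro borel_measurable_continuous_onI continuous_intros contf) (auto simp: less_imp_neq[symmetric])
  then have meas: "\<phi> n \<in> borel_measurable lborel" for n
    by simp
  have bd: "0 \<le> \<phi> n x" "\<phi> n x \<le> 1" for n x
    using pos[of x] by (auto simp: \<phi>_def power_le_one)
  have bd': "norm (?g x * \<phi> n x) \<le> norm (?g x)" for n x
    using bd[of n x] mult_left_le[of "\<phi> n x" "\<bar>?g x\<bar>"] by (simp add: abs_mult)
  have "(\<lambda>n. \<integral>x. ?g x * \<phi> n x \<partial>lborel) \<longlonglongrightarrow> (\<integral>x. ?g x \<partial>lborel)"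
  proof (rule integral_dominated_convergence[where w = "\<lambda>x. norm (?g x)"])
    show "?g \<in> borel_measurable lborel" using int by auto
    show "(\<lambda>x. ?g x * \<phi> n x) \<in> borel_measurable lborel" for n
      by (rule borel_measurable_times[OF _ meas]) (use int in auto)
    show "integrable lborel (\<lambda>x. norm (?g x))" using int by (rule integrable_norm)
    show "AE x in lborel. (\<lambda>n. ?g x * \<phi> n x) \<longlonglongrightarrow> ?g x"
    proof (intro AE_I2)
      fix x
      have "(\<lambda>n. ?g x * \<phi> n x) \<longlonglongrightarrow> ?g x * (max 0 (1 - 0 / f x))\<^sup>2"
        unfolding \<phi>_def using pos[of x]
        by (intro tendsto_intros LIMSEQ_inverse_real_of_nat) auto
      then show "(\<lambda>n. ?g x * \<phi> n x) \<longlonglongrightarrow> ?g x" by simp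
    qed
    show "AE x in lborel. norm (?g x * \<phi> n x) \<le> norm (?g x)" for n
      using bd'[of _ n] by (intro AE_I2)
  qed
  moreover have "0 \<le> (\<integral>x. ?g x * \<phi> n x \<partial>lborel)" for n
  proof -
    have "integrable lborel (\<lambda>x. ?g x * \<phi> n x)"
      by (rule Bochner_Integration.integrable_bound[OF int])
        (use int meas bd' in \<open>auto intro: borel_measurable_times\<close>)
    from has_integral_integral_lborel[OF this] show ?thesis
      unfolding \<phi>_def by (intro truncated_dissipation_nonneg[OF f v h pos lim]) auto
  qed
  ultimately show ?thesis by (intro LIMSEQ_le_const) auto
qed

section \<open>From the integral inequality to densities\<close>

text \<open>Supplies the triple \<open>v = (ln f)'\<close>, \<open>h = Hf f\<close>,
  \<open>h' = deriv (Hf f)\<close> for the integral inequality. The quotients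
  \<open>v = f'/f\<close> and \<open>h = (f'^2 - f f'')/f^2\<close> are differentiable because
  \<open>f\<close> is smooth and never 0.\<close>

lemma Hf_derivatives:
  assumes "smooth_fun f" and pos: "\<And>x. f x > 0"
  shows "(f has_real_derivative deriv (\<lambda>y. ln (f y)) x * f x) (at x)"
    and "(deriv (\<lambda>y. ln (f y)) has_real_derivative - Hf f x) (at x)"
    and "(Hf f has_real_derivative deriv (Hf f) x) (at x)"
proof -
  define f1 f2 f3 where "f1 = nderiv 1 f" and "f2 = nderiv 2 f" and "f3 = nderiv 3 f"
  have D: "(nderiv n f has_real_derivative nderiv (Suc n) f x) (at x)" for n x
    using assms(1) unfolding smooth_fun_def nderiv_def
    by (simp add: DERIV_deriv_iff_real_differentiable)
  have f: "(f has_real_derivative f1 x) (at x)" for x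
    using D[of 0 x] by (simp add: nderiv_def f1_def)
  have f1: "(f1 has_real_derivative f2 x) (at x)" for x
    using D[of 1 x] by (simp add: f1_def f2_def numeral_2_eq_2)
  have f2: "(f2 has_real_derivative f3 x) (at x)" for x
    using D[of 2 x] by (simp add: f3_def f2_def numeral_3_eq_3 numeral_2_eq_2)
  have v: "deriv (\<lambda>y. ln (f y)) = (\<lambda>x. f1 x / f x)"
    using pos by (intro ext DERIV_imp_deriv) (auto intro!: derivative_eq_intros f simp: divide_simps)
  have v': "((\<lambda>x. f1 x / f x) has_real_derivative (f2 x * f x - f1 x * f1 x) / (f x * f x)) (at x)" for x
    using pos[of x] by (auto intro!: derivative_eq_intros f f1)
  have h: "Hf f = (\<lambda>x. - ((f2 x * f x - f1 x * f1 x) / (f x * f x)))"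
    using DERIV_imp_deriv[OF v'] by (simp add: Hf_def nderiv_def numeral_2_eq_2 v)
  have h': "Hf f differentiable at x" for x
    unfolding h using f f1 f2 pos[of x]
    by (intro derivative_intros) (auto simp: real_differentiable_def)
  show "(f has_real_derivative deriv (\<lambda>y. ln (f y)) x * f x) (at x)"
    using f[of x] pos[of x] by (simp add: v)
  show "(deriv (\<lambda>y. ln (f y)) has_real_derivative - Hf f x) (at x)"
    using v'[of x] by (simp add: v h)
  show "(Hf f has_real_derivative deriv (Hf f) x) (at x)"
    using h' by (simp add: DERIV_deriv_iff_real_differentiable)
qed

lemma admissible1_ratio_ge_1:
  assumes "admissible1 f"
  shows "1 \<le> Ifun f * Dfun f / (Qfun f)\<^sup>2"
proof -
  from assms have sm: "smooth_fun f" and pos: "\<And>x. f x > 0" and rd: "rapidly_decaying f"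
    and I: "integrable lborel (integrand_I f)" and Q: "integrable lborel (integrand_Q f)"
    and D: "integrable lborel (integrand_D f)" and Q0: "Qfun f > 0"
    by (auto simp: admissible1_def)
  have lim: "(f \<longlongrightarrow> 0) at_infinity"
    using rd[unfolded rapidly_decaying_def, rule_format, of 0] by simp
  have quad: "0 \<le> Dfun f - 2 * l * Qfun f + l\<^sup>2 * Ifun f" for l
  proof -
    let ?g = "\<lambda>x. ((deriv (Hf f) x)\<^sup>2 + 2 * Hf f x ^ 3 - 2 * l * (Hf f x)\<^sup>2 + l\<^sup>2 * Hf f x) * f x"
    have g: "?g = (\<lambda>x. integrand_D f x - (2 * l) * integrand_Q f x + l\<^sup>2 * integrand_I f x)"
      by (auto simp: integrand_D_def integrand_Q_def integrand_I_def algebra_simps)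
    have "integrable lborel ?g"
      unfolding g using I Q D by auto
    then have "0 \<le> (\<integral>x. ?g x \<partial>lborel)"
      by (intro dissipation_nonneg[where v = "deriv (\<lambda>y. ln (f y))"] Hf_derivatives sm pos lim)
    also have "\<dots> = Dfun f - 2 * l * Qfun f + l\<^sup>2 * Ifun f"
      unfolding g Dfun_def Qfun_def Ifun_def using I Q D by simp
    finally show ?thesis .
  qed
  have "Ifun f > 0"
  proof (rule ccontr)
    assume "\<not> Ifun f > 0"
    \<comment> \<open>With \<open>I\<close> nonpositive the quadratic is at most
      \<open>D - 2 l Q\<close>; this \<open>l\<close> makes \<open>2 l Q\<close> exceed
      \<open>|D|\<close> by 1, so the quadratic would be negative.\<close>
    define l where "l = (\<bar>Dfun f\<bar> + 1) / (2 * Qfun f)"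
    have "l\<^sup>2 * Ifun f \<le> 0" using \<open>\<not> Ifun f > 0\<close> by (simp add: mult_nonneg_nonpos)
    moreover have "2 * l * Qfun f = \<bar>Dfun f\<bar> + 1" using Q0 by (simp add: l_def)
    ultimately show False using quad[of l] by linarith
  qed
  \<comment> \<open>This is the minimiser of the quadratic, where its value is
    \<open>D - Q^2 / I\<close>.\<close>
  with quad[of "Qfun f / Ifun f"] have "(Qfun f)\<^sup>2 \<le> Ifun f * Dfun f"
    by (simp add: field_simps power2_eq_square)
  with Q0 show ?thesis by (simp add: divide_simps)
qed

section \<open>Oscillating Gaussians\<close>

text \<open>A family closed under differentiation contains all iterated derivatives of its members,
  by induction on the order.\<close>

lemma smooth_funI:
  assumes "f \<in> S" and S: "\<And>g. g \<in> S \<Longrightarrow> \<exists>g'\<in>S. \<forall>x. (g has_real_derivative g' x) (at x)"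
  shows "smooth_fun f"
proof -
  have "nderiv n f \<in> S" for n
  proof (induction n)
    case 0
    then show ?case using assms(1) by (simp add: nderiv_def)
  next
    case (Suc n)
    from S[OF this] obtain g' where "g' \<in> S" "\<And>x. (nderiv n f has_real_derivative g' x) (at x)"
      by blast
    moreover from this have "nderiv (Suc n) f = g'"
      by (auto simp: nderiv_def intro: DERIV_imp_deriv)
    ultimately show ?case by simp
  qed
  then show ?thesis
    unfolding smooth_fun_def using S by (meson real_differentiable_def)
qed

text \<open>The algebra generated by \<open>f\<close>, the identity, the constants and two
  trigonometric functions. It is closed under differentiation once it contains \<open>f'\<close>,
  which gives smoothness without formulas for higher derivatives.\<close>

inductive_set trig_alg :: "(real \<Rightarrow> real) \<Rightarrow> real \<Rightarrow> (real \<Rightarrow> real) set" for f t where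
  base: "f \<in> trig_alg f t"
| const: "(\<lambda>x. c) \<in> trig_alg f t"
| ident: "(\<lambda>x. x) \<in> trig_alg f t"
| sin: "(\<lambda>x. sin (t * x)) \<in> trig_alg f t"
| cos: "(\<lambda>x. cos (t * x)) \<in> trig_alg f t"
| add: "g \<in> trig_alg f t \<Longrightarrow> h \<in> trig_alg f t \<Longrightarrow> (\<lambda>x. g x + h x) \<in> trig_alg f t"
| mult: "g \<in> trig_alg f t \<Longrightarrow> h \<in> trig_alg f t \<Longrightarrow> (\<lambda>x. g x * h x) \<in> trig_alg f t"

lemma trig_alg_derivative:
  assumes "g \<in> trig_alg f t" and f': "f' \<in> trig_alg f t"
    and D: "\<And>x. (f has_real_derivative f' x) (at x)"
  shows "\<exists>g'\<in>trig_alg f t. \<forall>x. (g has_real_derivative g' x) (at x)"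
  using assms(1)
proof induction
  case base
  then show ?case using f' D by blast
next
  case (const c)
  show ?case by (rule bexI[OF _ trig_alg.const[of 0]]) (auto intro!: derivative_eq_intros)
next
  case ident
  show ?case by (rule bexI[OF _ trig_alg.const[of 1]]) (auto intro!: derivative_eq_intros)
next
  case sin
  show ?case
    by (rule bexI[OF _ trig_alg.mult[OF trig_alg.const[of t] trig_alg.cos]])
      (auto intro!: derivative_eq_intros)
next
  case cos
  show ?case
    by (rule bexI[OF _ trig_alg.mult[OF trig_alg.const[of "-t"] trig_alg.sin]])
      (auto intro!: derivative_eq_intros)
next
  case (add g h)
  then obtain g' h' where "g' \<in> trig_alg f t" "h' \<in> trig_alg f t"
    "\<And>x. (g has_real_derivative g' x) (at x)" "\<And>x. (h has_real_derivative h' x) (at x)" by blast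
  then show ?case
    by (intro bexI[OF _ trig_alg.add[of g' _ _ h']]) (auto intro!: derivative_eq_intros)
next
  case (mult g h)
  then obtain g' h' where "g' \<in> trig_alg f t" "h' \<in> trig_alg f t"
    "\<And>x. (g has_real_derivative g' x) (at x)" "\<And>x. (h has_real_derivative h' x) (at x)" by blast
  with mult.hyps show ?case
    by (intro bexI[OF _ trig_alg.add[OF trig_alg.mult[of g' _ _ h] trig_alg.mult[of g _ _ h']]])
      (auto intro!: derivative_eq_intros)
qed

text \<open>Not normalised: the mass is divided out later by a constant \<open>c\<close>. Keeping
  the Gaussian density as a factor turns every integral into a Gaussian average.\<close>

definition osc :: "real \<Rightarrow> real \<Rightarrow> real \<Rightarrow> real" where
  "osc a t x = std_normal_density x * exp (a * cos (t * x))"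

lemma osc_pos: "0 < osc a t x"
  by (simp add: osc_def normal_density_pos)

text \<open>The derivative is written with \<open>(-1) * x\<close> and
  \<open>(-a * t) * sin (t * x)\<close> so that the rules of \<open>trig_alg\<close> build it
  directly.\<close>

lemma has_real_derivative_osc:
  "(osc a t has_real_derivative osc a t x * ((-1) * x + (-a * t) * sin (t * x))) (at x)"
proof -
  define C :: real where "C = 1 / sqrt (2 * pi)"
  have "osc a t = (\<lambda>x. C * exp (- x\<^sup>2 / 2) * exp (a * cos (t * x)))"
    by (simp add: osc_def[abs_def] std_normal_density_def C_def)
  then show ?thesis
    by (auto intro!: derivative_eq_intros simp: algebra_simps)
qed

lemma smooth_fun_osc: "smooth_fun (\<lambda>x. c * osc a t x)"
proof (rule smooth_funI[where S = "trig_alg (osc a t) t"])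
  show "(\<lambda>x. c * osc a t x) \<in> trig_alg (osc a t) t"
    by (intro trig_alg.intros)
  have "(\<lambda>x. osc a t x * ((-1) * x + (-a * t) * sin (t * x))) \<in> trig_alg (osc a t) t"
    by (intro trig_alg.intros)
  then show "\<exists>g'\<in>trig_alg (osc a t) t. \<forall>x. (g has_real_derivative g' x) (at x)"
    if "g \<in> trig_alg (osc a t) t" for g
    using that has_real_derivative_osc trig_alg_derivative by blast
qed

lemma rapidly_decaying_osc: "rapidly_decaying (\<lambda>x. c * osc a t x)"
  unfolding rapidly_decaying_def
proof
  fix k
  \<comment> \<open>The factor \<open>exp \<bar>a\<bar>\<close> bounds the oscillating part;
    \<open>exp (1/2)\<close> comes from \<open>- x^2/2 \<le> 1/2 - |x|\<close>, that is, from
    \<open>(|x| - 1)^2 \<ge> 0\<close>.\<close>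
  define C where "C = \<bar>c\<bar> * exp (\<bar>a\<bar> + 1/2)"
  show "((\<lambda>x. \<bar>x\<bar> ^ k * (c * osc a t x)) \<longlongrightarrow> 0) at_infinity"
  proof (rule Lim_null_comparison)
    have "norm (\<bar>x\<bar> ^ k * (c * osc a t x)) \<le> C * (\<bar>x\<bar> ^ k / exp \<bar>x\<bar>)" for x
    proof -
      have "1 / sqrt (2 * pi) \<le> 1" using pi_gt3 by simp
      then have "osc a t x \<le> exp (- x\<^sup>2 / 2) * exp (a * cos (t * x))"
        unfolding osc_def std_normal_density_def by (intro mult_right_mono mult_left_le_one_le) auto
      also have "\<dots> = exp (- x\<^sup>2 / 2 + a * cos (t * x))" by (simp only: exp_add)
      also have "\<dots> \<le> exp (\<bar>a\<bar> + 1/2 - \<bar>x\<bar>)"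
      proof -
        have "a * cos (t * x) \<le> \<bar>a\<bar>"
          using mult_left_le[of "\<bar>cos (t * x)\<bar>" "\<bar>a\<bar>"] abs_ge_self[of "a * cos (t * x)"]
          by (simp add: abs_mult)
        moreover have "0 \<le> (\<bar>x\<bar> - 1)\<^sup>2" by simp
        ultimately show ?thesis by (simp add: power2_diff)
      qed
      finally have "osc a t x \<le> exp (\<bar>a\<bar> + 1/2) / exp \<bar>x\<bar>" by (simp add: exp_diff)
      then have "\<bar>c\<bar> * \<bar>x\<bar> ^ k * osc a t x \<le> \<bar>c\<bar> * \<bar>x\<bar> ^ k * (exp (\<bar>a\<bar> + 1/2) / exp \<bar>x\<bar>)"
        by (intro mult_left_mono) auto
      then show ?thesis using osc_pos[of a t x]
        by (simp add: C_def abs_mult power_abs algebra_simps)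
    qed
    then show "\<forall>\<^sub>F x in at_infinity. norm (\<bar>x\<bar> ^ k * (c * osc a t x)) \<le> C * (\<bar>x\<bar> ^ k / exp \<bar>x\<bar>)"
      by simp
    have "((\<lambda>x::real. \<bar>x\<bar> ^ k / exp \<bar>x\<bar>) \<longlongrightarrow> 0) at_infinity"
      using filterlim_compose[OF tendsto_power_div_exp_0[of k] filterlim_norm_at_top[where 'a = real]] by simp
    then show "((\<lambda>x. C * (\<bar>x\<bar> ^ k / exp \<bar>x\<bar>)) \<longlongrightarrow> 0) at_infinity"
      by (rule tendsto_mult_right_zero)
  qed
qed

text \<open>The normalising constant only shifts the logarithm, so it drops out.\<close>

lemma Hf_osc:
  assumes "c > 0"
  shows "Hf (\<lambda>x. c * osc a t x) = (\<lambda>x. 1 + a * t\<^sup>2 * cos (t * x))"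
proof -
  have "(\<lambda>x. ln (c * osc a t x)) = (\<lambda>x. ln c + ln (1 / sqrt (2 * pi)) + (- x\<^sup>2 / 2 + a * cos (t * x)))"
    unfolding osc_def std_normal_density_def using assms by (auto simp: ln_mult ln_div)
  moreover have "deriv (\<lambda>x. ln c + ln (1 / sqrt (2 * pi)) + (- x\<^sup>2 / 2 + a * cos (t * x)))
      = (\<lambda>x. - x - a * t * sin (t * x))"
    by (intro ext DERIV_imp_deriv) (auto intro!: derivative_eq_intros)
  moreover have "deriv (\<lambda>x. - x - a * t * sin (t * x)) = (\<lambda>x. - 1 - a * t\<^sup>2 * cos (t * x))"
    by (intro ext DERIV_imp_deriv) (auto intro!: derivative_eq_intros simp: power2_eq_square)
  ultimately show ?thesis
    by (simp add: Hf_def nderiv_def numeral_2_eq_2 add.commute)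
qed

lemma deriv_Hf_osc:
  assumes "c > 0"
  shows "deriv (Hf (\<lambda>x. c * osc a t x)) = (\<lambda>x. - (a * t ^ 3 * sin (t * x)))"
  unfolding Hf_osc[OF assms]
  by (intro ext DERIV_imp_deriv)
    (auto intro!: derivative_eq_intros simp: power2_eq_square power3_eq_cube)

section \<open>Gaussian averages\<close>

lemma integrable_std_normal_bounded:
  fixes k :: "real \<Rightarrow> real"
  assumes "continuous_on UNIV k" and "\<And>x. \<bar>k x\<bar> \<le> C"
  shows "integrable lborel (\<lambda>x. std_normal_density x * k x)"
proof (rule Bochner_Integration.integrable_bound)
  show "integrable lborel (\<lambda>x. std_normal_density x * C)" by simp
  show "(\<lambda>x. std_normal_density x * k x) \<in> borel_measurable lborel"
    using borel_measurable_continuous_onI[OF assms(1)] by simp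
  show "AE x in lborel. norm (std_normal_density x * k x) \<le> norm (std_normal_density x * C)"
    using assms(2) by (intro AE_I2) (auto simp: abs_mult intro!: mult_left_mono order_trans[OF _ abs_ge_self])
qed

text \<open>The Gaussian has mass 1, so a uniform error passes to the averages with the same
  constant.\<close>

lemma std_normal_integral_diff_le:
  fixes k l :: "real \<Rightarrow> real"
  assumes "integrable lborel (\<lambda>x. std_normal_density x * k x)"
    and "integrable lborel (\<lambda>x. std_normal_density x * l x)"
    and "\<And>x. \<bar>k x - l x\<bar> \<le> C"
  shows "\<bar>(\<integral>x. std_normal_density x * k x \<partial>lborel) - (\<integral>x. std_normal_density x * l x \<partial>lborel)\<bar> \<le> C"
proof -
  have "\<bar>(\<integral>x. std_normal_density x * k x \<partial>lborel) - (\<integral>x. std_normal_density x * l x \<partial>lborel)\<bar>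
    = \<bar>\<integral>x. std_normal_density x * k x - std_normal_density x * l x \<partial>lborel\<bar>"
    using assms(1,2) by simp
  also have "\<dots> \<le> (\<integral>x. \<bar>std_normal_density x * k x - std_normal_density x * l x\<bar> \<partial>lborel)"
    by (rule integral_abs_bound)
  also have "\<dots> \<le> (\<integral>x. std_normal_density x * C \<partial>lborel)"
  proof (rule integral_mono)
    fix x
    have "\<bar>std_normal_density x * k x - std_normal_density x * l x\<bar> = std_normal_density x * \<bar>k x - l x\<bar>"
      by (simp flip: right_diff_distrib add: abs_mult)
    with assms(3)[of x] show "\<bar>std_normal_density x * k x - std_normal_density x * l x\<bar> \<le> std_normal_density x * C"
      by (simp add: mult_left_mono)
  qed (use assms in auto)
  also have "\<dots> = C" by simp
  finally show ?thesis .
qed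

text \<open>This is the real part of the characteristic function of the standard normal law.\<close>

lemma std_normal_integral_cos:
  "(\<integral>x. std_normal_density x * cos (t * x) \<partial>lborel) = exp (- t\<^sup>2 / 2)"
proof -
  interpret real_distribution std_normal_distribution by (rule real_dist_normal_dist)
  have "exp (- t\<^sup>2 / 2) = Re (char std_normal_distribution t)"
    by (simp add: char_std_normal_distribution)
  also have "\<dots> = (\<integral>x. cos (t * x) \<partial>std_normal_distribution)"
    unfolding char_def
    using integral_Re[of std_normal_distribution "\<lambda>x. iexp (t * x)"] integrable_iexp[of "\<lambda>x. t * x"]
    by (simp add: Re_exp)
  also have "\<dots> = (\<integral>x. std_normal_density x * cos (t * x) \<partial>lborel)"
    by (subst integral_density) auto
  finally show ?thesis ..
qed

lemma std_normal_integral_cos_sq: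
  "(\<integral>x. std_normal_density x * (cos (t * x))\<^sup>2 \<partial>lborel) = (1 + exp (- 2 * t\<^sup>2)) / 2"
proof -
  have "(\<integral>x. std_normal_density x * (cos (t * x))\<^sup>2 \<partial>lborel)
    = (\<integral>x. (std_normal_density x + std_normal_density x * cos ((2 * t) * x)) / 2 \<partial>lborel)"
  proof (intro Bochner_Integration.integral_cong refl)
    fix x
    have "cos ((2 * t) * x) = 2 * (cos (t * x))\<^sup>2 - 1"
      using cos_double_cos[of "t * x"] by (simp only: mult.assoc)
    then show "std_normal_density x * (cos (t * x))\<^sup>2
        = (std_normal_density x + std_normal_density x * cos ((2 * t) * x)) / 2"
      by (simp only:) (simp add: algebra_simps)
  qed
  also have "\<dots> = (1 + exp (- (2 * t)\<^sup>2 / 2)) / 2"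
    by (subst integral_divide_zero, subst Bochner_Integration.integral_add)
      (auto simp: std_normal_integral_cos intro!: integrable_std_normal_bounded[where C = 1] continuous_intros)
  finally show ?thesis by (simp add: power_mult_distrib)
qed

lemma std_normal_integral_sin_sq:
  "(\<integral>x. std_normal_density x * (sin (t * x))\<^sup>2 \<partial>lborel) = (1 - exp (- 2 * t\<^sup>2)) / 2"
proof -
  have "(\<integral>x. std_normal_density x * (sin (t * x))\<^sup>2 \<partial>lborel)
    = (\<integral>x. std_normal_density x - std_normal_density x * (cos (t * x))\<^sup>2 \<partial>lborel)"
    by (intro Bochner_Integration.integral_cong) (auto simp: sin_squared_eq algebra_simps)
  also have "\<dots> = 1 - (1 + exp (- 2 * t\<^sup>2)) / 2"
    by (subst Bochner_Integration.integral_diff)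
      (auto simp: std_normal_integral_cos_sq abs_square_le_1
        intro!: integrable_std_normal_bounded[where C = 1] continuous_intros)
  finally show ?thesis by (simp add: field_simps)
qed

section \<open>Pointwise errors for small amplitude\<close>

lemma abs_exp_minus_linear_le:
  fixes x :: real
  assumes "\<bar>x\<bar> \<le> 1"
  shows "\<bar>exp x - 1 - x\<bar> \<le> x\<^sup>2"
proof -
  have "exp x \<le> 1 + x + x\<^sup>2"
  proof (cases "x \<ge> 0")
    case True
    with assms show ?thesis by (intro exp_bound) auto
  next
    case False
    define y where "y = - x"
    have y: "0 \<le> y" using False by (simp add: y_def)
    \<comment> \<open>For negative \<open>x = - y\<close> the claim
      \<open>exp (- y) \<le> 1 - y + y^2\<close> is multiplied by \<open>exp y\<close>, which is
      then replaced by its quadratic Taylor polynomial.\<close>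
    have "1 \<le> (1 - y + y\<^sup>2) * (1 + y + y\<^sup>2 / 2)"
    proof -
      have "(1 - y + y\<^sup>2) * (1 + y + y\<^sup>2 / 2) = 1 + y\<^sup>2 / 2 + y ^ 3 / 2 + y ^ 4 / 2"
        by (simp add: field_simps power2_eq_square power3_eq_cube power4_eq_xxxx)
      with y show ?thesis by simp
    qed
    also have "\<dots> \<le> (1 - y + y\<^sup>2) * exp y"
    proof (rule mult_left_mono)
      show "1 + y + y\<^sup>2 / 2 \<le> exp y" using y by (rule exp_lower_Taylor_quadratic)
      have "1 - y + y\<^sup>2 = (y - 1/2)\<^sup>2 + 3/4" by (simp add: power2_eq_square algebra_simps)
      then show "0 \<le> 1 - y + y\<^sup>2" by simp
    qed
    finally show ?thesis by (simp add: y_def exp_minus field_simps)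
  qed
  then show ?thesis using exp_ge_add_one_self[of x] by linarith
qed

text \<open>Here \<open>c\<close> and \<open>s\<close> stand for the cosine and sine, and the bounds
  are uniform in both. The constant 50 is set by the third bound, where the errors are
  \<open>2 * a\<close> and \<open>48 * a\<close>.\<close>

lemma osc_integrand_bounds:
  fixes a c s :: real
  assumes a: "0 < a" "a \<le> 1" and c: "\<bar>c\<bar> \<le> 1" and s: "\<bar>s\<bar> \<le> 1"
  shows "\<bar>(a\<^sup>2 + c / a) * exp (a * c) - (c / a + c\<^sup>2)\<bar> \<le> 50 * a"
    and "\<bar>(a ^ 3 + c)\<^sup>2 * exp (a * c) - c\<^sup>2\<bar> \<le> 50 * a"
    and "\<bar>(s\<^sup>2 + 2 * a * (a ^ 3 + c) ^ 3) * exp (a * c) - s\<^sup>2\<bar> \<le> 50 * a"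
proof -
  have mul: "\<bar>x * y\<bar> \<le> X * Y" if "\<bar>x\<bar> \<le> X" "\<bar>y\<bar> \<le> Y" for x y X Y :: real
    using that by (auto simp: abs_mult intro!: mult_mono)
  define E where "E = exp (a * c)"
  have ac: "\<bar>a * c\<bar> \<le> a" using mul[of a a c 1] a c by simp
  have a2: "a\<^sup>2 \<le> a" using a by (simp add: power2_eq_square mult_left_le)
  have a3: "a ^ 3 \<le> a" using power_decreasing[of 1 3 a] a by simp
  have a6: "a ^ 6 \<le> a" using power_decreasing[of 1 6 a] a by simp
  have c2: "\<bar>c\<^sup>2\<bar> \<le> 1" "\<bar>s\<^sup>2\<bar> \<le> 1" using c s by (auto simp: abs_square_le_1)
  have "\<bar>E - 1 - a * c\<bar> \<le> (a * c)\<^sup>2"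
    unfolding E_def using ac a by (intro abs_exp_minus_linear_le) auto
  also have "\<dots> \<le> a\<^sup>2" using ac a by (simp add: power2_le_iff_abs_le)
  finally have r: "\<bar>E - 1 - a * c\<bar> \<le> a\<^sup>2" .
  with ac a2 have E1: "\<bar>E - 1\<bar> \<le> 2 * a" by linarith
  with a have E3: "\<bar>E\<bar> \<le> 3" by linarith
  \<comment> \<open>The singular \<open>c / a\<close> forces a second-order expansion of
    \<open>E\<close>: its linear term \<open>a * c\<close> yields the \<open>c^2\<close> that
    survives averaging, and the remainder, of order \<open>a^2\<close>, can still be divided by
    \<open>a\<close>.\<close>
  have "(a\<^sup>2 + c / a) * E - (c / a + c\<^sup>2) = a\<^sup>2 * E + c * ((E - 1 - a * c) / a)"
    using a by (simp add: field_simps power2_eq_square)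
  moreover have "\<bar>a\<^sup>2 * E\<bar> \<le> a * 3" using a a2 E3 by (intro mul) auto
  moreover have "\<bar>c * ((E - 1 - a * c) / a)\<bar> \<le> 1 * a"
    using c r a by (intro mul) (auto simp: field_simps power2_eq_square)
  ultimately show "\<bar>(a\<^sup>2 + c / a) * exp (a * c) - (c / a + c\<^sup>2)\<bar> \<le> 50 * a"
    unfolding E_def[symmetric] using a by linarith
  have "(a ^ 3 + c)\<^sup>2 * E - c\<^sup>2 = (a ^ 6 + 2 * (a ^ 3 * c)) * E + c\<^sup>2 * (E - 1)"
    by (simp add: algebra_simps power2_eq_square power3_eq_cube numeral_eq_Suc)
  moreover have "\<bar>a ^ 3 * c\<bar> \<le> a * 1" using a3 a c by (intro mul) auto
  then have "\<bar>(a ^ 6 + 2 * (a ^ 3 * c)) * E\<bar> \<le> (3 * a) * 3"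
    using a6 E3 zero_le_power[of a 6] a by (intro mul) linarith+
  moreover have "\<bar>c\<^sup>2 * (E - 1)\<bar> \<le> 1 * (2 * a)" using c2 E1 by (intro mul)
  ultimately show "\<bar>(a ^ 3 + c)\<^sup>2 * exp (a * c) - c\<^sup>2\<bar> \<le> 50 * a"
    unfolding E_def[symmetric] using a by linarith
  have "(s\<^sup>2 + 2 * a * (a ^ 3 + c) ^ 3) * E - s\<^sup>2 = s\<^sup>2 * (E - 1) + (2 * a) * ((a ^ 3 + c) ^ 3 * E)"
    by (simp add: algebra_simps)
  moreover have "\<bar>s\<^sup>2 * (E - 1)\<bar> \<le> 1 * (2 * a)" using c2 E1 by (intro mul)
  \<comment> \<open>The cubic part carries an extra factor \<open>a\<close>, so a crude bound on it
    suffices.\<close>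
  moreover have "\<bar>a ^ 3 + c\<bar> ^ 3 \<le> 2 ^ 3" using a3 zero_le_power[of a 3] a c by (intro power_mono) linarith+
  then have "\<bar>(2 * a) * ((a ^ 3 + c) ^ 3 * E)\<bar> \<le> (2 * a) * (2 ^ 3 * 3)"
    using a E3 by (intro mul) (auto simp: power_abs)
  ultimately show "\<bar>(s\<^sup>2 + 2 * a * (a ^ 3 + c) ^ 3) * exp (a * c) - s\<^sup>2\<bar> \<le> 50 * a"
    unfolding E_def[symmetric] by (simp only:) (rule order_trans[OF abs_triangle_ineq], simp)
qed

lemma integrable_std_normal_trig:
  "integrable lborel (\<lambda>x. std_normal_density x * ((p + q * cos (t * x)) * exp (a * cos (t * x))))"
  "integrable lborel (\<lambda>x. std_normal_density x * ((p + q * cos (t * x))\<^sup>2 * exp (a * cos (t * x))))"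
  "integrable lborel (\<lambda>x. std_normal_density x *
    (((sin (t * x))\<^sup>2 + r * (p + q * cos (t * x)) ^ 3) * exp (a * cos (t * x))))"
proof -
  have mul: "\<bar>x * y\<bar> \<le> X * Y" if "\<bar>x\<bar> \<le> X" "\<bar>y\<bar> \<le> Y" for x y X Y :: real
    using that by (auto simp: abs_mult intro!: mult_mono)
  have h: "\<bar>p + q * cos (t * x)\<bar> \<le> \<bar>p\<bar> + \<bar>q\<bar>" for x
    using mul[of q "\<bar>q\<bar>" "cos (t * x)" 1] by (simp add: abs_triangle_ineq[THEN order_trans])
  have e: "\<bar>exp (a * cos (t * x))\<bar> \<le> exp \<bar>a\<bar>" for x
    using mul[of a "\<bar>a\<bar>" "cos (t * x)" 1] by simp
  have h2: "\<bar>(p + q * cos (t * x)) ^ n\<bar> \<le> (\<bar>p\<bar> + \<bar>q\<bar>) ^ n" for x n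
    unfolding power_abs using h[of x] by (intro power_mono) auto
  have h3: "\<bar>(sin (t * x))\<^sup>2 + r * (p + q * cos (t * x)) ^ 3\<bar> \<le> 1 + \<bar>r\<bar> * (\<bar>p\<bar> + \<bar>q\<bar>) ^ 3" for x
    using mul[OF order_refl[of "\<bar>r\<bar>"] h2[of x 3]] abs_sin_le_one[of "t * x"]
    by (intro order_trans[OF abs_triangle_ineq] add_mono) (auto simp: abs_square_le_1)
  show "integrable lborel (\<lambda>x. std_normal_density x * ((p + q * cos (t * x)) * exp (a * cos (t * x))))"
    by (intro integrable_std_normal_bounded continuous_intros, rule mul[OF h e])
  show "integrable lborel (\<lambda>x. std_normal_density x * ((p + q * cos (t * x))\<^sup>2 * exp (a * cos (t * x))))"
    by (intro integrable_std_normal_bounded continuous_intros, rule mul[OF h2 e])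
  show "integrable lborel (\<lambda>x. std_normal_density x *
    (((sin (t * x))\<^sup>2 + r * (p + q * cos (t * x)) ^ 3) * exp (a * cos (t * x))))"
    by (intro integrable_std_normal_bounded continuous_intros, rule mul[OF h3 e])
qed

lemma integrable_osc: "integrable lborel (osc a t)"
  using integrable_std_normal_trig(1)[of 1 0 t a] unfolding osc_def[abs_def] by simp

text \<open>The perturbing factor is at least \<open>exp (- \<bar>a\<bar>)\<close>; this permits
  normalisation.\<close>

lemma integral_osc_pos: "0 < (\<integral>x. osc a t x \<partial>lborel)"
proof -
  have "0 < (\<integral>x. std_normal_density x * exp (- \<bar>a\<bar>) \<partial>lborel)" by simp
  also have "\<dots> \<le> (\<integral>x. osc a t x \<partial>lborel)"
  proof (rule integral_mono[OF _ integrable_osc])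
    fix x
    have "\<bar>a * cos (t * x)\<bar> \<le> \<bar>a\<bar>" unfolding abs_mult by (rule mult_left_le) auto
    then show "std_normal_density x * exp (- \<bar>a\<bar>) \<le> osc a t x"
      unfolding osc_def by (intro mult_left_mono) auto
  qed simp
  finally show ?thesis .
qed

section \<open>Rescaled functionals of the trial densities\<close>

context
  fixes a c t :: real
  assumes a: "a > 0" and c: "c > 0"
  defines "t \<equiv> 1 / a\<^sup>2"
begin

text \<open>With \<open>t = 1/a^2\<close>, \<open>h = (a^3 + cos) / a^3\<close> and
  \<open>h' = - sin / a^5\<close>. Thus \<open>h'^2\<close> has size \<open>a^-10\<close> and
  \<open>h^3\<close> only \<open>a^-9\<close>. For \<open>I\<close> the power is
  \<open>a^-2\<close>, since the leading term \<open>cos / a^3\<close> nearly averages out.\<close>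

lemma integrand_osc:
  "integrand_I (\<lambda>x. c * osc a t x) = (\<lambda>x. c / a\<^sup>2 *
    (std_normal_density x * ((a\<^sup>2 + 1 / a * cos (t * x)) * exp (a * cos (t * x)))))"
  "integrand_Q (\<lambda>x. c * osc a t x) = (\<lambda>x. c / a ^ 6 *
    (std_normal_density x * ((a ^ 3 + 1 * cos (t * x))\<^sup>2 * exp (a * cos (t * x)))))"
  "integrand_D (\<lambda>x. c * osc a t x) = (\<lambda>x. c / a ^ 10 *
    (std_normal_density x * (((sin (t * x))\<^sup>2 + 2 * a * (a ^ 3 + 1 * cos (t * x)) ^ 3) * exp (a * cos (t * x)))))"
proof -
  have 1: "1 + a * t\<^sup>2 * y = (a\<^sup>2 + 1 / a * y) / a\<^sup>2" for y
    using a by (simp add: t_def field_simps power2_eq_square)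
  have 2: "1 + a * t\<^sup>2 * y = (a ^ 3 + 1 * y) / a ^ 3" for y
    using a by (simp add: t_def field_simps power2_eq_square power3_eq_cube)
  have 3: "- (a * t ^ 3 * y) = - y / a ^ 5" for y
    using a by (simp add: t_def field_simps power2_eq_square numeral_eq_Suc)
  have 4: "(- y / a ^ 5)\<^sup>2 + 2 * (w / a ^ 3) ^ 3 = (y\<^sup>2 + 2 * a * w ^ 3) / a ^ 10" for y w
  proof -
    have "a ^ 10 = a * a ^ 9" by (simp flip: power_Suc)
    then have "2 * a * w ^ 3 / a ^ 10 = 2 * w ^ 3 / a ^ 9" using a by simp
    then show ?thesis by (simp add: power_divide add_divide_distrib flip: power_mult)
  qed
  show "integrand_I (\<lambda>x. c * osc a t x) = (\<lambda>x. c / a\<^sup>2 *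
    (std_normal_density x * ((a\<^sup>2 + 1 / a * cos (t * x)) * exp (a * cos (t * x)))))"
    unfolding integrand_I_def Hf_osc[OF c] 1 by (simp add: osc_def mult_ac)
  show "integrand_Q (\<lambda>x. c * osc a t x) = (\<lambda>x. c / a ^ 6 *
    (std_normal_density x * ((a ^ 3 + 1 * cos (t * x))\<^sup>2 * exp (a * cos (t * x)))))"
    unfolding integrand_Q_def Hf_osc[OF c] 2 by (simp add: osc_def power_divide mult_ac flip: power_mult)
  show "integrand_D (\<lambda>x. c * osc a t x) = (\<lambda>x. c / a ^ 10 *
    (std_normal_density x * (((sin (t * x))\<^sup>2 + 2 * a * (a ^ 3 + 1 * cos (t * x)) ^ 3) * exp (a * cos (t * x)))))"
    unfolding integrand_D_def deriv_Hf_osc[OF c] unfolding Hf_osc[OF c] 2 3 4 by (simp add: osc_def mult_ac)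
qed

end

text \<open>Powers of \<open>a\<close> are factored out of the three functionals so that what remains tends to 1/2;
  the factors cancel in the ratio. The redundant \<open>1 *\<close> keeps the integrands in the shape of
  \<open>integrable_std_normal_trig\<close>.\<close>

definition scaled_I :: "real \<Rightarrow> real" where
  "scaled_I a = (\<integral>x. std_normal_density x *
    ((a\<^sup>2 + 1 / a * cos (1 / a\<^sup>2 * x)) * exp (a * cos (1 / a\<^sup>2 * x))) \<partial>lborel)"

definition scaled_Q :: "real \<Rightarrow> real" where
  "scaled_Q a = (\<integral>x. std_normal_density x *
    ((a ^ 3 + 1 * cos (1 / a\<^sup>2 * x))\<^sup>2 * exp (a * cos (1 / a\<^sup>2 * x))) \<partial>lborel)"

definition scaled_D :: "real \<Rightarrow> real" where
  "scaled_D a = (\<integral>x. std_normal_density x * (((sin (1 / a\<^sup>2 * x))\<^sup>2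
    + 2 * a * (a ^ 3 + 1 * cos (1 / a\<^sup>2 * x)) ^ 3) * exp (a * cos (1 / a\<^sup>2 * x))) \<partial>lborel)"

lemma admissible1_osc:
  assumes a: "a > 0" and Q: "scaled_Q a > 0"
  defines "f \<equiv> \<lambda>x. inverse (\<integral>y. osc a (1 / a\<^sup>2) y \<partial>lborel) * osc a (1 / a\<^sup>2) x"
  shows "admissible1 f"
    and "Ifun f * Dfun f / (Qfun f)\<^sup>2 = scaled_I a * scaled_D a / (scaled_Q a)\<^sup>2"
proof -
  define c where "c = inverse (\<integral>y. osc a (1 / a\<^sup>2) y \<partial>lborel)"
  have c: "c > 0" unfolding c_def using integral_osc_pos by simp
  have f: "f = (\<lambda>x. c * osc a (1 / a\<^sup>2) x)" by (simp add: f_def c_def)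
  note integrands = integrand_osc[OF a c]
  have 1: "Ifun f = c / a\<^sup>2 * scaled_I a" "Qfun f = c / a ^ 6 * scaled_Q a"
    "Dfun f = c / a ^ 10 * scaled_D a"
    unfolding f Ifun_def Qfun_def Dfun_def integrands scaled_I_def scaled_Q_def scaled_D_def
    by (rule integral_mult_right_zero)+
  \<comment> \<open>The powers match because 2 + 10 = 2 * 6.\<close>
  have ID: "Ifun f * Dfun f = (c / a ^ 6)\<^sup>2 * (scaled_I a * scaled_D a)"
    by (simp add: 1 power_divide power2_eq_square[of c] flip: power_mult power_add)
  show "Ifun f * Dfun f / (Qfun f)\<^sup>2 = scaled_I a * scaled_D a / (scaled_Q a)\<^sup>2"
    unfolding ID 1(2) power_mult_distrib using a c by simp
  have "integrable lborel (integrand_I f)" "integrable lborel (integrand_Q f)"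
    "integrable lborel (integrand_D f)"
    unfolding f integrands by (intro integrable_mult_right integrable_std_normal_trig)+
  moreover have "integrable lborel f"
    unfolding f by (intro integrable_mult_right integrable_osc)
  moreover have "(\<integral>x. f x \<partial>lborel) = 1"
    unfolding f using integral_osc_pos[of a "1 / a\<^sup>2"] by (simp add: c_def)
  moreover have "Qfun f > 0" using 1 a c Q by simp
  ultimately show "admissible1 f"
    unfolding admissible1_def unfolding f
    using c osc_pos smooth_fun_osc rapidly_decaying_osc by simp
qed

section \<open>Limits as the amplitude tends to 0\<close>

lemma
  assumes a: "0 < a" "a \<le> 1"
  shows scaled_I_bound: "\<bar>scaled_I a -
      (exp (- (1 / a\<^sup>2)\<^sup>2 / 2) / a + (1 + exp (- 2 * (1 / a\<^sup>2)\<^sup>2)) / 2)\<bar> \<le> 50 * a"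
    and scaled_Q_bound: "\<bar>scaled_Q a - (1 + exp (- 2 * (1 / a\<^sup>2)\<^sup>2)) / 2\<bar> \<le> 50 * a"
    and scaled_D_bound: "\<bar>scaled_D a - (1 - exp (- 2 * (1 / a\<^sup>2)\<^sup>2)) / 2\<bar> \<le> 50 * a"
proof -
  let ?t = "1 / a\<^sup>2"
  have i: "integrable lborel (\<lambda>x. std_normal_density x * cos (?t * x))"
    "integrable lborel (\<lambda>x. std_normal_density x * (cos (?t * x))\<^sup>2)"
    "integrable lborel (\<lambda>x. std_normal_density x * (sin (?t * x))\<^sup>2)"
    using a by (auto intro!: integrable_std_normal_bounded[where C = 1] continuous_intros simp: abs_square_le_1)
  have e: "std_normal_density x * (cos (?t * x) / a + (cos (?t * x))\<^sup>2)
    = std_normal_density x * cos (?t * x) / a + std_normal_density x * (cos (?t * x))\<^sup>2" for x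
    by (simp add: algebra_simps)
  \<comment> \<open>The term \<open>exp (- t^2 / 2) / a\<close> is the average of the singular
    \<open>cos / a\<close>; with \<open>t = 1/a^2\<close> it still tends to 0.\<close>
  have val: "(\<integral>x. std_normal_density x * (cos (?t * x) / a + (cos (?t * x))\<^sup>2) \<partial>lborel)
    = exp (- ?t\<^sup>2 / 2) / a + (1 + exp (- 2 * ?t\<^sup>2)) / 2"
    unfolding e Bochner_Integration.integral_add[OF integrable_divide[OF i(1)] i(2)] integral_divide_zero
      std_normal_integral_cos std_normal_integral_cos_sq ..
  have int: "integrable lborel (\<lambda>x. std_normal_density x * (cos (?t * x) / a + (cos (?t * x))\<^sup>2))"
    unfolding e using i by (intro Bochner_Integration.integrable_add integrable_divide)
  show "\<bar>scaled_I a - (exp (- ?t\<^sup>2 / 2) / a + (1 + exp (- 2 * ?t\<^sup>2)) / 2)\<bar> \<le> 50 * a"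
    unfolding scaled_I_def val[symmetric]
    by (intro std_normal_integral_diff_le integrable_std_normal_trig int)
      (use osc_integrand_bounds(1)[OF a, of "cos (?t * x)" "sin (?t * x)" for x] in simp)
  show "\<bar>scaled_Q a - (1 + exp (- 2 * ?t\<^sup>2)) / 2\<bar> \<le> 50 * a"
    unfolding scaled_Q_def std_normal_integral_cos_sq[symmetric]
    by (intro std_normal_integral_diff_le integrable_std_normal_trig i)
      (use osc_integrand_bounds(2)[OF a, of "cos (?t * x)" "sin (?t * x)" for x] in simp)
  show "\<bar>scaled_D a - (1 - exp (- 2 * ?t\<^sup>2)) / 2\<bar> \<le> 50 * a"
    unfolding scaled_D_def std_normal_integral_sin_sq[symmetric]
    by (intro std_normal_integral_diff_le integrable_std_normal_trig i)
      (use osc_integrand_bounds(3)[OF a, of "cos (?t * x)" "sin (?t * x)" for x] in simp)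
qed

lemma
  shows scaled_I_tendsto: "(scaled_I \<longlongrightarrow> 1 / 2) (at_right 0)"
    and scaled_Q_tendsto: "(scaled_Q \<longlongrightarrow> 1 / 2) (at_right 0)"
    and scaled_D_tendsto: "(scaled_D \<longlongrightarrow> 1 / 2) (at_right 0)"
proof -
  have ev: "\<forall>\<^sub>F a in at_right (0::real). 0 < a \<and> a \<le> 1"
    unfolding eventually_at_right_field by (intro exI[of _ 1]) auto
  have lim: "(F \<longlongrightarrow> L) (at_right 0)"
    if "\<And>a. 0 < a \<Longrightarrow> a \<le> 1 \<Longrightarrow> \<bar>F a - G a\<bar> \<le> 50 * a" and G: "(G \<longlongrightarrow> L) (at_right 0)"
    for F G :: "real \<Rightarrow> real" and L
  proof -
    have "((\<lambda>a. F a - G a) \<longlongrightarrow> 0) (at_right 0)"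
    proof (rule Lim_null_comparison)
      show "\<forall>\<^sub>F a in at_right 0. norm (F a - G a) \<le> 50 * a"
        using ev by eventually_elim (use that(1) in auto)
      show "((\<lambda>a::real. 50 * a) \<longlongrightarrow> 0) (at_right 0)" by real_asymp
    qed
    from tendsto_add[OF this G] show ?thesis by simp
  qed
  show "(scaled_I \<longlongrightarrow> 1 / 2) (at_right 0)"
    by (rule lim[OF scaled_I_bound]) (assumption | real_asymp)+
  show "(scaled_Q \<longlongrightarrow> 1 / 2) (at_right 0)"
    by (rule lim[OF scaled_Q_bound]) (assumption | real_asymp)+
  show "(scaled_D \<longlongrightarrow> 1 / 2) (at_right 0)"
    by (rule lim[OF scaled_D_bound]) (assumption | real_asymp)+
qed

theorem theorem7p1:
  shows "theta1_star = 1"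
proof -
  define S where "S = {Ifun f * Dfun f / (Qfun f)\<^sup>2 | f. admissible1 f}"
  have lower: "1 \<le> r" if "r \<in> S" for r
    using that admissible1_ratio_ge_1 by (auto simp: S_def)
  have upper: "\<exists>r\<in>S. r < 1 + e" if "e > 0" for e
  proof -
    have "((\<lambda>a. scaled_I a * scaled_D a / (scaled_Q a)\<^sup>2) \<longlongrightarrow> (1/2) * (1/2) / (1/2)\<^sup>2) (at_right 0)"
      by (intro tendsto_intros scaled_I_tendsto scaled_D_tendsto scaled_Q_tendsto) simp
    then have "\<forall>\<^sub>F a in at_right 0. scaled_I a * scaled_D a / (scaled_Q a)\<^sup>2 < 1 + e"
      by (rule order_tendstoD(2)) (use that in \<open>simp add: power2_eq_square\<close>)
    moreover have "\<forall>\<^sub>F a in at_right 0. scaled_Q a > 0"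
      by (rule order_tendstoD(1)[OF scaled_Q_tendsto]) simp
    moreover have "\<forall>\<^sub>F a in at_right (0::real). 0 < a" by (rule eventually_at_right_less)
    ultimately have "\<forall>\<^sub>F a in at_right (0::real). \<exists>r\<in>S. r < 1 + e"
    proof eventually_elim
      case (elim a)
      with admissible1_osc[of a] show ?case unfolding S_def by auto
    qed
    \<comment> \<open>The statement no longer depends on \<open>a\<close>, and
      \<open>at_right 0\<close> is a nontrivial filter.\<close>
    then show ?thesis by (simp add: trivial_limit_at_right_real)
  qed
  have "Inf S = 1"
  proof (rule antisym)
    have "bdd_below S" using lower by (auto simp: bdd_below_def)
    show "Inf S \<le> 1"
    proof (rule field_le_epsilon)
      fix e :: real assume "e > 0"
      then obtain r where "r \<in> S" "r < 1 + e" using upper by blast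
      with cInf_lower[OF \<open>r \<in> S\<close> \<open>bdd_below S\<close>] show "Inf S \<le> 1 + e" by simp
    qed
    \<comment> \<open>Here \<open>upper[of 1]\<close> serves to show that \<open>S\<close> is
      nonempty.\<close>
    show "1 \<le> Inf S" using upper[of 1] lower by (intro cInf_greatest) auto
  qed
  then show ?thesis by (simp add: theta1_star_def S_def)
qed

end
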